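(* Let $A=(\mathbf{a}_1,\dots,\mathbf{a}_J)$ and $B=(\mathbf{b}_1,\dots,\mathbf{b}_K)$ be configurations (integer matrices with columns $\mathbf{a}_j$ and $\mathbf{b}_k$) that are homogeneous, i.e. there exist weight vectors $w,v$ with $\langle w,\mathbf{a}_j\rangle=1$ for all $j$ and $\langle v,\mathbf{b}_k\rangle=1$ for all $k$. Let $\mathcal{B}_A$ and $\mathcal{B}_B$ be Markov bases for $A$ and $B$, respectively. Then the set consisting of (i) all basic moves $\mathbf{e}_{j_1k_1}+\mathbf{e}_{j_2k_2}-\mathbf{e}_{j_1k_2}-\mathbf{e}_{j_2k_1}$ with $j_1,j_2\in\{1,\dots,J\}$, $k_1,k_2\in\{1,\dots,K\}$, (ii) all moves $z^A(k_1,\dots,k_{\deg z^A})$ with $z^A\in\mathcal{B}_A$ and $1\le k_1,\dots,k_{\deg z^A}\le K$, (iii) all moves $z^B(j_1,\dots,j_{\deg z^B})$ with $z^B\in\mathcal{B}_B$ and $1\le j_1,\dots,j_{\deg z^B}\le J$, is a Markov basis for the Segre product $A\otimes B$.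
   Context: Configurations and Markov bases: for an integer matrix $C$ with columns indexed by a finite set $\mathcal{I}$ of cells, a table is a vector $x\in\mathbb{Z}_{\ge0}^{\mathcal I}$, a move is $z\in\mathbb{Z}^{\mathcal I}$ with $Cz=0$, and the fiber of $t$ is $\{x\in\mathbb{Z}_{\ge 0}^{\mathcal I}: Cx=t\}$. A Markov basis for $C$ is a finite set $\mathcal{B}$ of moves such that any two tables $x,y$ in the same fiber (for every fiber) can be joined by a finite sequence of tables in that fiber in which consecutive tables differ by $\pm z$ for some $z\in\mathcal{B}$. Segre product: $A\otimes B$ is the matrix with columns $\begin{pmatrix}\mathbf{a}_j\\ \mathbf{b}_k\end{pmatrix}$ indexed by the cells $(j,k)$, $1\le j\le J$, $1\le k\le K$. Notation: for a move $z^A=(z^A_1,\dots,z^A_J)$ of $A$, $\deg z^A=\sum_j\max(z^A_j,0)=\sum_j\max(-z^A_j,0)$ (equal by homogeneity). With $\mathbf{e}_j$ the $j$-th unit vector of $\mathbb{Z}^J$, $z^A$ is uniquely written as $z^A=\sum_{h=1}^{\deg z^A}(\mathbf{e}_{j_h}-\mathbf{e}_{j'_h})$ with $j_1\le\dots\le j_{\deg z^A}$, $j'_1\le\dots\le j'_{\deg z^A}$, where $j_1,j_2,\dots$ list the cells of the positive part of $z^A$ with multiplicity and $j'_1,j'_2,\dots$ those of the negative part. Let $\mathbf{e}_{jk}$ be the $J\times K$ table with $1$ at cell $(j,k)$ and $0$ elsewhere. For arbitrary (not necessarily ordered) $k_1,\dots,k_{\deg z^A}\in\{1,\dots,K\}$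 define $$z^A(k_1,\dots,k_{\deg z^A})=\sum_{h=1}^{\deg z^A}(\mathbf{e}_{j_hk_h}-\mathbf{e}_{j'_hk_h}).$$ Similarly, for a move $z^B=\sum_{h=1}^{\deg z^B}(\mathbf{e}_{k_h}-\mathbf{e}_{k'_h})$ of $B$ (sorted in the same way) and $j_1,\dots,j_{\deg z^B}\in\{1,\dots,J\}$, define $z^B(j_1,\dots,j_{\deg z^B})=\sum_{h=1}^{\deg z^B}(\mathbf{e}_{j_hk_h}-\mathbf{e}_{j_hk'_h})$. *)

theory Defs
  imports "HOL-Analysis.Analysis"
begin

text \<open>
  A configuration with rows \<open>'d\<close> and cells \<open>'i\<close> is a matrix of type \<open>int ^ 'i ^ 'd\<close>, its
  columns being the vectors \<open>column i C\<close>; tables and moves are vectors of type \<open>int ^ 'i\<close>.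
  A finite linearly ordered type \<open>'j\<close> plays the role of the ordered index set \<open>{1,\<dots>,J}\<close>.
\<close>

definition homogeneous :: "int ^ 'i ^ 'd \<Rightarrow> bool" where
  "homogeneous C \<longleftrightarrow> (\<exists>w :: real ^ 'd. \<forall>i. w \<bullet> column i (map_matrix real_of_int C) = 1)"

definition is_table :: "int ^ 'i \<Rightarrow> bool" where
  "is_table x \<longleftrightarrow> (\<forall>i. 0 \<le> x $ i)"

definition is_move :: "int ^ 'i ^ 'd \<Rightarrow> int ^ 'i \<Rightarrow> bool" where
  "is_move C z \<longleftrightarrow> C *v z = 0"

definition fiber :: "int ^ 'i ^ 'd \<Rightarrow> int ^ 'd \<Rightarrow> (int ^ 'i) set" where
  "fiber C t = {x. is_table x \<and> C *v x = t}"

definition fiber_steps :: "int ^ 'i ^ 'd \<Rightarrow> (int ^ 'i) set \<Rightarrow> int ^ 'd \<Rightarrow> (int ^ 'i) rel" where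
  "fiber_steps C M t =
     {(x, y). x \<in> fiber C t \<and> y \<in> fiber C t \<and> (\<exists>z\<in>M. y - x = z \<or> y - x = - z)}"

definition markov_basis :: "int ^ 'i ^ 'd \<Rightarrow> (int ^ 'i) set \<Rightarrow> bool" where
  "markov_basis C M \<longleftrightarrow>
     finite M \<and> (\<forall>z\<in>M. is_move C z) \<and>
     (\<forall>t. \<forall>x\<in>fiber C t. \<forall>y\<in>fiber C t. (x, y) \<in> (fiber_steps C M t)\<^sup>*)"

definition segre_product ::
    "int ^ 'j ^ 'd \<Rightarrow> int ^ 'k ^ 'e \<Rightarrow> int ^ ('j \<times> 'k) ^ ('d + 'e)" where
  "segre_product A B =
     (\<chi> r c. case r of Inl i \<Rightarrow> A $ i $ fst c | Inr i \<Rightarrow> B $ i $ snd c)"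

definition deg :: "int ^ 'i \<Rightarrow> nat" where
  "deg z = nat (\<Sum>i\<in>UNIV. max (z $ i) 0)"

text \<open>
  The cells of the positive part and of the negative part in increasing order, each repeated
  according to its multiplicity (\<open>nat\<close> sends negative integers to \<open>0\<close>). For a move of a
  homogeneous configuration both lists have length \<open>deg z\<close>.
\<close>

definition pos_cells :: "int ^ ('i::{finite,linorder}) \<Rightarrow> 'i list" where
  "pos_cells z = concat (map (\<lambda>i. replicate (nat (z $ i)) i) (sorted_list_of_set UNIV))"

definition neg_cells :: "int ^ ('i::{finite,linorder}) \<Rightarrow> 'i list" where
  "neg_cells z = concat (map (\<lambda>i. replicate (nat (- (z $ i))) i) (sorted_list_of_set UNIV))"

text \<open>\<open>axis (j, k) 1\<close> is the table with \<open>1\<close> at cell \<open>(j, k)\<close> and \<open>0\<close> elsewhere.\<close>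

definition basic_move :: "'j::finite \<Rightarrow> 'j \<Rightarrow> 'k::finite \<Rightarrow> 'k \<Rightarrow> int ^ ('j \<times> 'k)" where
  "basic_move j1 j2 k1 k2 =
     axis (j1, k1) 1 + axis (j2, k2) 1 - axis (j1, k2) 1 - axis (j2, k1) 1"

definition lift_left ::
    "int ^ ('j::{finite,linorder}) \<Rightarrow> 'k::finite list \<Rightarrow> int ^ ('j \<times> 'k)" where
  "lift_left z ks =
     (\<Sum>h<deg z. axis (pos_cells z ! h, ks ! h) 1 - axis (neg_cells z ! h, ks ! h) 1)"

definition lift_right ::
    "int ^ ('k::{finite,linorder}) \<Rightarrow> 'j::finite list \<Rightarrow> int ^ ('j \<times> 'k)" where
  "lift_right z js =
     (\<Sum>h<deg z. axis (js ! h, pos_cells z ! h) 1 - axis (js ! h, neg_cells z ! h) 1)"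

end

theory Submission imports Defs begin

text \<open>
  The matrix of the Segre product sees a table \<open>x\<close> only through its two one-way marginals: it
  maps \<open>x\<close> to the pair consisting of \<open>A\<close> times the row sums and \<open>B\<close> times the column sums
  (\<open>segre_product_mult\<close>). So two tables \<open>x\<close>, \<open>y\<close> lie in the same fiber exactly when their row
  sums lie in a common fiber of \<open>A\<close> and their column sums in a common fiber of \<open>B\<close>, and \<open>x\<close> is
  joined to \<open>y\<close> in three stages.

  The Markov basis of \<open>A\<close> gives a path from the row sums of \<open>x\<close> to those of \<open>y\<close>. Each step \<open>z\<close>
  of this path is lifted to a step on two-way tables that has row sums \<open>z\<close> and column sums \<open>0\<close>:
  the units that \<open>z\<close> takes away from the row sums are present somewhere in the rows of the current
  table (\<open>select_cells\<close>), and each of them is carried to its new row within the column in which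
  it was found (\<open>lift_stays_table\<close>). This leads from \<open>x\<close> to a table with the row sums of \<open>y\<close> and
  the column sums of \<open>x\<close> (\<open>lift_path\<close>). The same argument with the roles of rows and columns
  exchanged corrects the column sums. The last table and \<open>y\<close> have the same marginals, and basic
  moves join them, because a suitable basic move always brings two distinct tables with
  equal marginals closer together (\<open>connected_by_basic_moves\<close>).

  Homogeneity enters through the fact that the entries of a move then add up to \<open>0\<close>, so that the
  positive and the negative cells of the move can be paired off.
\<close>

section \<open>Tables as multisets of cells\<close>

definition unit_sum :: "'i::finite list \<Rightarrow> int ^ 'i" where
  "unit_sum cs = (\<Sum>c\<leftarrow>cs. axis c 1)"

lemma unit_sum_simps [simp]:
  "unit_sum [] = 0"
  "unit_sum (c # cs) = axis c 1 + unit_sum cs"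
  by (simp_all add: unit_sum_def)

lemma unit_sum_nth: "unit_sum cs $ i = int (count_list cs i)"
  by (induction cs) (auto simp: axis_def)

lemma unit_sum_conv_sum: "unit_sum cs = (\<Sum>h<length cs. axis (cs ! h) 1)"
  by (simp add: unit_sum_def sum_list_sum_nth atLeast0LessThan)

lemma is_table_unit_sum: "is_table (unit_sum cs)"
  by (simp add: is_table_def unit_sum_nth)

lemma is_table_add: "is_table x \<Longrightarrow> is_table y \<Longrightarrow> is_table (x + y)"
  by (simp add: is_table_def)

lemma count_list_replicate: "count_list (replicate n a) b = (if a = b then n else 0)"
  by (induction n) auto

lemma count_list_concat_replicate:
  assumes "distinct xs"
  shows "count_list (concat (map (\<lambda>i. replicate (n i) i) xs)) j = (if j \<in> set xs then n j else 0)"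
  using assms by (induction xs) (auto simp: count_list_replicate)

lemma unit_sum_pos_cells: "unit_sum (pos_cells z) $ i = max (z $ i) 0"
  by (simp add: unit_sum_nth pos_cells_def count_list_concat_replicate)

lemma unit_sum_neg_cells: "unit_sum (neg_cells z) $ i = max (- (z $ i)) 0"
  by (simp add: unit_sum_nth neg_cells_def count_list_concat_replicate)

lemma move_eq_pos_minus_neg: "z = unit_sum (pos_cells z) - unit_sum (neg_cells z)"
  by (simp add: vec_eq_iff unit_sum_pos_cells unit_sum_neg_cells max_def)

lemma is_table_diff_neg:
  assumes "is_table u" and "is_table (u + z)"
  shows "is_table (u - unit_sum (neg_cells z))"
  unfolding is_table_def
proof
  fix i
  have "0 \<le> u $ i" "0 \<le> (u + z) $ i" using assms unfolding is_table_def by blast+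
  then show "0 \<le> (u - unit_sum (neg_cells z)) $ i" by (simp add: unit_sum_neg_cells)
qed

lemma is_table_diff_pos:
  assumes "is_table u" and "is_table (u - z)"
  shows "is_table (u - unit_sum (pos_cells z))"
  unfolding is_table_def
proof
  fix i
  have "0 \<le> u $ i" "0 \<le> (u - z) $ i" using assms unfolding is_table_def by blast+
  then show "0 \<le> (u - unit_sum (pos_cells z)) $ i" by (simp add: unit_sum_pos_cells)
qed

lemma sum_unit_sum: "(\<Sum>i\<in>UNIV. unit_sum cs $ i) = int (length cs)"
  by (induction cs) (auto simp: sum.distrib axis_def)

lemma length_pos_cells: "length (pos_cells z) = deg z"
  using sum_unit_sum[of "pos_cells z"] by (simp add: deg_def unit_sum_pos_cells)

text \<open>Pairing a move with the weight vector of the configuration shows that its entries add up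
  to zero, so it has as many negative units as positive ones.\<close>

lemma length_neg_cells:
  fixes C :: "int ^ ('i::{finite,linorder}) ^ 'd"
  assumes "homogeneous C" and "is_move C z"
  shows "length (neg_cells z) = deg z"
proof -
  obtain w :: "real ^ 'd" where w: "w \<bullet> column i (map_matrix real_of_int C) = 1" for i
    using assms(1) unfolding homogeneous_def by blast
  have w1: "(\<Sum>r\<in>UNIV. w $ r * real_of_int (C $ r $ i)) = 1" for i
    using w[of i] by (simp add: inner_vec_def column_def map_matrix_def)
  have z0: "(\<Sum>i\<in>UNIV. C $ r $ i * z $ i) = 0" for r
    using assms(2) by (simp add: is_move_def vec_eq_iff matrix_vector_mult_def)
  have "(\<Sum>i\<in>UNIV. real_of_int (z $ i))
      = (\<Sum>i\<in>UNIV. (\<Sum>r\<in>UNIV. w $ r * real_of_int (C $ r $ i)) * real_of_int (z $ i))"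
    by (simp add: w1)
  also have "\<dots> = (\<Sum>r\<in>UNIV. w $ r * real_of_int (\<Sum>i\<in>UNIV. C $ r $ i * z $ i))"
    unfolding sum_distrib_right of_int_sum sum_distrib_left
    by (subst sum.swap) (simp add: mult.assoc)
  also have "\<dots> = 0" by (simp only: z0) simp
  finally have "(\<Sum>i\<in>UNIV. z $ i) = 0"
    by (metis of_int_eq_0_iff of_int_sum)
  moreover have "(\<Sum>i\<in>UNIV. z $ i)
      = (\<Sum>i\<in>UNIV. unit_sum (pos_cells z) $ i - unit_sum (neg_cells z) $ i)"
    by (subst move_eq_pos_minus_neg) simp
  ultimately show ?thesis
    by (simp add: sum_subtractf sum_unit_sum length_pos_cells)
qed

section \<open>Marginals\<close>

text \<open>Row sums and column sums of a two-way table are its marginals along \<open>fst\<close> and \<open>snd\<close>;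
  an arbitrary \<open>f\<close> lets both be treated at once.\<close>

definition marginal :: "('c::finite \<Rightarrow> 'i::finite) \<Rightarrow> int ^ 'c \<Rightarrow> int ^ 'i" where
  "marginal f x = (\<chi> i. \<Sum>c | f c = i. x $ c)"

lemma marginal_add: "marginal f (x + y) = marginal f x + marginal f y"
  by (simp add: marginal_def vec_eq_iff sum.distrib)

lemma marginal_diff: "marginal f (x - y) = marginal f x - marginal f y"
  by (simp add: marginal_def vec_eq_iff sum_subtractf)

lemma marginal_zero: "marginal f 0 = 0"
  by (simp add: marginal_def vec_eq_iff)

lemma marginal_axis: "marginal f (axis c 1) = axis (f c) 1"
  by (auto simp: marginal_def vec_eq_iff axis_def)

lemma marginal_unit_sum: "marginal f (unit_sum cs) = unit_sum (map f cs)"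
  by (induction cs) (simp_all add: marginal_zero marginal_add marginal_axis)

lemma is_table_marginal: "is_table x \<Longrightarrow> is_table (marginal f x)"
  by (simp add: is_table_def marginal_def sum_nonneg)

lemma sum_mult_marginal:
  "(\<Sum>c\<in>UNIV. a (f c) * x $ c) = (\<Sum>i\<in>UNIV. a i * marginal f x $ i)"
proof -
  have "(\<Sum>i\<in>UNIV. a i * marginal f x $ i) = (\<Sum>i\<in>UNIV. \<Sum>c | c \<in> UNIV \<and> f c = i. a (f c) * x $ c)"
    by (simp add: marginal_def sum_distrib_left)
  also have "\<dots> = (\<Sum>c\<in>UNIV. a (f c) * x $ c)"
    by (rule sum.group) auto
  finally show ?thesis by simp
qed

lemma segre_product_mult:
  "segre_product A B *v x =
     (\<chi> r. case r of Inl i \<Rightarrow> (A *v marginal fst x) $ i | Inr i \<Rightarrow> (B *v marginal snd x) $ i)"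
  by (auto simp: vec_eq_iff segre_product_def matrix_vector_mult_def split: sum.split
      intro: sum_mult_marginal)

lemma segre_product_mult_eq_iff:
  "segre_product A B *v x = segre_product A B *v y \<longleftrightarrow>
     A *v marginal fst x = A *v marginal fst y \<and> B *v marginal snd x = B *v marginal snd y"
  by (auto simp: segre_product_mult vec_eq_iff split_sum_all)

lemma is_move_segre_product:
  "is_move (segre_product A B) z \<longleftrightarrow> is_move A (marginal fst z) \<and> is_move B (marginal snd z)"
  using segre_product_mult_eq_iff[of A B z 0] by (simp add: is_move_def marginal_zero)

text \<open>An excess of \<open>x\<close> over \<open>y\<close> in one cell must be compensated by another cell that is counted
  in the same entry of the marginal.\<close>

lemma compensating_cell:
  assumes "marginal f x = marginal f y" and "y $ c < x $ c"
  shows "\<exists>c'. f c' = f c \<and> x $ c' < y $ c'"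
proof (rule ccontr)
  assume "\<not> ?thesis"
  then have "\<forall>c'\<in>{c'. f c' = f c}. y $ c' \<le> x $ c'" by force
  then have "(\<Sum>c' | f c' = f c. y $ c') < (\<Sum>c' | f c' = f c. x $ c')"
    using assms(2) by (intro sum_strict_mono_ex1) auto
  then show False
    using assms(1) by (simp add: marginal_def vec_eq_iff)
qed

section \<open>Connecting tables with equal marginals\<close>

lemma fiber_stepI:
  assumes "is_table x" "is_table y" "C *v x = t" "C *v y = t" "z \<in> M" "y = x + z \<or> y = x - z"
  shows "(x, y) \<in> fiber_steps C M t"
  using assms by (auto simp: fiber_steps_def fiber_def)

lemma marginal_basic_move:
  "marginal fst (basic_move j1 j2 k1 k2) = 0" "marginal snd (basic_move j1 j2 k1 k2) = 0"
  by (simp_all add: basic_move_def marginal_add marginal_diff marginal_axis)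

text \<open>Induction on the \<open>\<ell>\<^sub>1\<close> distance. If \<open>x\<close> exceeds \<open>y\<close> in a cell, compensation along its row
  and then along the column reached there gives three corners of a rectangle where \<open>x - y\<close> has
  signs \<open>+\<close>, \<open>-\<close>, \<open>+\<close>. The basic move on this rectangle brings \<open>x\<close> closer to \<open>y\<close> in
  these three corners, and the fourth corner can undo only one unit of that gain. It takes units
  only from the two corners where \<open>x > y \<ge> 0\<close>, so the result is again a table.\<close>

lemma connected_by_basic_moves:
  fixes A :: "int ^ ('j::finite) ^ 'd" and B :: "int ^ ('k::finite) ^ 'e"
  assumes M: "\<And>j1 j2 k1 k2. basic_move j1 j2 k1 k2 \<in> M"
    and "is_table x" and y: "is_table y" and t: "segre_product A B *v x = t"
    and "marginal fst x = marginal fst y" and "marginal snd x = marginal snd y"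
  shows "(x, y) \<in> (fiber_steps (segre_product A B) M t)\<^sup>*"
  using assms(2,4-)
proof (induction "nat (\<Sum>c\<in>UNIV. \<bar>x $ c - y $ c\<bar>)" arbitrary: x rule: less_induct)
  case less
  show ?case
  proof (cases "x = y")
    case False
    then obtain c where c: "x $ c \<noteq> y $ c" by (auto simp: vec_eq_iff)
    have "\<exists>c. y $ c < x $ c"
    proof (cases "y $ c < x $ c")
      case False
      with c have "x $ c < y $ c" by simp
      from compensating_cell[OF less.prems(3)[symmetric] this] show ?thesis by blast
    qed blast
    then obtain j1 k1 where p11: "y $ (j1, k1) < x $ (j1, k1)" by auto
    from compensating_cell[OF less.prems(3) p11]
    obtain k2 where p12: "x $ (j1, k2) < y $ (j1, k2)" by auto
    from compensating_cell[OF less.prems(4)[symmetric] p12]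
    obtain j2 where p22: "y $ (j2, k2) < x $ (j2, k2)" by auto
    have ne: "j1 \<noteq> j2" "k1 \<noteq> k2" using p11 p12 p22 by auto
    define x' where "x' = x - basic_move j1 j2 k1 k2"
    have x'_nth: "x' $ c = x $ c - (if c = (j1, k1) then 1 else 0) - (if c = (j2, k2) then 1 else 0)
        + (if c = (j1, k2) then 1 else 0) + (if c = (j2, k1) then 1 else 0)" for c
      by (auto simp: x'_def basic_move_def axis_def)
    have x': "is_table x'"
      unfolding is_table_def
    proof
      fix c
      have "0 \<le> x $ c" "0 \<le> y $ c"
        using less.prems(1) y unfolding is_table_def by blast+
      then show "0 \<le> x' $ c"
        using p11 p22 ne by (auto simp: x'_nth)
    qed
    have marg: "marginal fst x' = marginal fst x" "marginal snd x' = marginal snd x"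
      by (simp_all add: x'_def marginal_diff marginal_basic_move)
    have t': "segre_product A B *v x' = t"
      using less.prems(2) marg segre_product_mult_eq_iff by metis
    have step: "(x, x') \<in> fiber_steps (segre_product A B) M t"
      using less.prems(1) x' less.prems(2) t' M[of j1 j2 k1 k2]
      by (rule fiber_stepI) (simp add: x'_def)
    have "(\<Sum>c\<in>UNIV. \<bar>x' $ c - y $ c\<bar>) \<le> (\<Sum>c\<in>UNIV. \<bar>x $ c - y $ c\<bar>
        - (if c = (j1, k1) then 1 else 0) - (if c = (j2, k2) then 1 else 0)
        - (if c = (j1, k2) then 1 else 0) + (if c = (j2, k1) then 1 else 0))"
      by (rule sum_mono) (use p11 p12 p22 ne in \<open>auto simp: x'_nth\<close>)
    also have "\<dots> = (\<Sum>c\<in>UNIV. \<bar>x $ c - y $ c\<bar>) - 2"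
      by (simp add: sum.distrib sum_subtractf)
    finally have "(\<Sum>c\<in>UNIV. \<bar>x' $ c - y $ c\<bar>) \<le> (\<Sum>c\<in>UNIV. \<bar>x $ c - y $ c\<bar>) - 2" .
    moreover have "0 \<le> (\<Sum>c\<in>UNIV. \<bar>x' $ c - y $ c\<bar>)" by (rule sum_nonneg) simp
    ultimately have "nat (\<Sum>c\<in>UNIV. \<bar>x' $ c - y $ c\<bar>) < nat (\<Sum>c\<in>UNIV. \<bar>x $ c - y $ c\<bar>)"
      by linarith
    from less.hyps[OF this x' t'] less.prems(3,4) marg
    have "(x', y) \<in> (fiber_steps (segre_product A B) M t)\<^sup>*" by simp
    with step show ?thesis by (rule converse_rtrancl_into_rtrancl)
  qed simp
qed

section \<open>Lifting moves and paths\<close>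

text \<open>Whatever can be removed from the marginal can be removed from the table: as long as the
  entry of the marginal at \<open>i\<close> is positive, some cell over \<open>i\<close> is occupied.\<close>

lemma select_cells:
  assumes "is_table x" and "is_table (marginal f x - unit_sum is)"
  shows "\<exists>cs. map f cs = is \<and> is_table (x - unit_sum cs)"
  using assms
proof (induction "is" arbitrary: x)
  case (Cons i "is")
  have "0 \<le> (marginal f x - unit_sum (i # is)) $ i"
    using Cons.prems(2) unfolding is_table_def by blast
  then have "0 < (\<Sum>c | f c = i. x $ c)"
    by (simp add: marginal_def unit_sum_nth axis_def)
  then obtain c where c: "f c = i" "0 < x $ c"
    by (metis (mono_tags, lifting) linorder_not_less mem_Collect_eq sum_nonpos)
  have "is_table (x - axis c 1)"
    using Cons.prems(1) c(2) by (auto simp: is_table_def axis_def)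
  moreover have "is_table (marginal f (x - axis c 1) - unit_sum is)"
    using Cons.prems(2) c(1) by (simp add: marginal_diff marginal_axis algebra_simps)
  ultimately obtain cs where "map f cs = is" "is_table (x - axis c 1 - unit_sum cs)"
    using Cons.IH by blast
  with c(1) show ?case
    by (intro exI[of _ "c # cs"]) (simp add: algebra_simps)
qed simp

text \<open>A cell of a two-way table has a coordinate \<open>f\<close>, on which a move acts, and a coordinate
  \<open>f'\<close>, which the lifted move leaves alone. The two ways to assign these roles to rows and
  columns give the two families of lifted moves.\<close>

locale cell_coordinates =
  fixes f :: "'c::finite \<Rightarrow> 'i::{finite,linorder}" and f' :: "'c \<Rightarrow> 'l::finite"
    and cell :: "'i \<Rightarrow> 'l \<Rightarrow> 'c"
  assumes f_cell [simp]: "f (cell i l) = i"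
    and f'_cell [simp]: "f' (cell i l) = l"
    and cell_coords [simp]: "cell (f c) (f' c) = c"
begin

definition lift :: "int ^ ('i::{finite,linorder}) \<Rightarrow> 'l list \<Rightarrow> int ^ 'c" where
  "lift z ls = unit_sum (map2 cell (pos_cells z) ls) - unit_sum (map2 cell (neg_cells z) ls)"

lemma lift_conv_sum:
  assumes "length (neg_cells z) = deg z" and "length ls = deg z"
  shows "lift z ls =
    (\<Sum>h<deg z. axis (cell (pos_cells z ! h) (ls ! h)) 1 - axis (cell (neg_cells z ! h) (ls ! h)) 1)"
  using assms by (simp add: lift_def unit_sum_conv_sum length_pos_cells sum_subtractf)

lemma map_coords_map2:
  "length is = length ls \<Longrightarrow> map f (map2 cell is ls) = is"
  "length is = length ls \<Longrightarrow> map f' (map2 cell is ls) = ls"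
  by (induction "is" ls rule: list_induct2) auto

lemma map2_coords: "map2 cell (map f cs) (map f' cs) = cs"
  by (induction cs) auto

lemma marginal_lift:
  assumes "length (neg_cells z) = deg z" and "length ls = deg z"
  shows "marginal f (lift z ls) = z" and "marginal f' (lift z ls) = 0"
  using assms move_eq_pos_minus_neg[of z]
  by (simp_all add: lift_def marginal_diff marginal_unit_sum map_coords_map2 length_pos_cells
      del: map_map)

text \<open>The indices \<open>ls\<close> are read off from the cells in which the units to be removed are found.\<close>

lemma lift_stays_table:
  assumes "is_table x" and "is_table (marginal f x - unit_sum is)"
  shows "\<exists>ls. length ls = length is \<and>
    is_table (x + unit_sum (map2 cell is' ls) - unit_sum (map2 cell is ls))"
proof -
  obtain cs where cs: "map f cs = is" "is_table (x - unit_sum cs)"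
    using select_cells[OF assms] by blast
  let ?ls = "map f' cs"
  have "map2 cell is ?ls = cs" using cs(1) map2_coords by blast
  moreover have "is_table ((x - unit_sum cs) + unit_sum (map2 cell is' ?ls))"
    by (intro is_table_add cs is_table_unit_sum)
  ultimately show ?thesis
    using cs(1) by (intro exI[of _ ?ls]) (auto simp: algebra_simps)
qed

text \<open>As \<open>v\<close> is nonnegative, the units that \<open>z\<close> (or \<open>- z\<close>) takes away are available in the
  marginal of \<open>x\<close>: they are the negative cells of \<open>z\<close> when \<open>z\<close> is added and its positive cells
  when it is subtracted.\<close>

lemma lift_step:
  assumes deg: "length (neg_cells z) = deg z"
    and x: "is_table x" and v: "is_table v" "v = marginal f x + z \<or> v = marginal f x - z"
  shows "\<exists>ls x'. length ls = deg z \<and> (x' = x + lift z ls \<or> x' = x - lift z ls) \<and>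
    is_table x' \<and> marginal f x' = v \<and> marginal f' x' = marginal f' x"
  using v(2)
proof
  assume v_eq: "v = marginal f x + z"
  have "is_table (marginal f x - unit_sum (neg_cells z))"
    using is_table_diff_neg[OF is_table_marginal[OF x]] v(1) v_eq by blast
  from lift_stays_table[OF x this, of "pos_cells z"]
  obtain ls where "length ls = deg z" "is_table (x + lift z ls)"
    by (auto simp: deg lift_def algebra_simps)
  then show ?thesis
    using v_eq marginal_lift[OF deg] by (metis add.right_neutral marginal_add)
next
  assume v_eq: "v = marginal f x - z"
  have "is_table (marginal f x - unit_sum (pos_cells z))"
    using is_table_diff_pos[OF is_table_marginal[OF x]] v(1) v_eq by blast
  from lift_stays_table[OF x this, of "neg_cells z"]
  obtain ls where "length ls = deg z" "is_table (x - lift z ls)"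
    by (auto simp: length_pos_cells lift_def algebra_simps)
  then show ?thesis
    using v_eq marginal_lift[OF deg] by (metis diff_zero marginal_diff)
qed

text \<open>The hypothesis on \<open>C\<close> abstracts from the Segre product: the fiber of a two-way table is
  determined by the fiber of its \<open>f\<close>-marginal and by its \<open>f'\<close>-marginal.\<close>

lemma lift_path:
  fixes D :: "int ^ ('i::{finite,linorder}) ^ 'd"
  assumes hom: "homogeneous D" and moves: "\<And>z. z \<in> N \<Longrightarrow> is_move D z"
    and C: "\<And>x y. D *v marginal f x = D *v marginal f y \<Longrightarrow> marginal f' x = marginal f' y
      \<Longrightarrow> C *v x = C *v y"
    and M: "\<And>z ls. z \<in> N \<Longrightarrow> length ls = deg z \<Longrightarrow> lift z ls \<in> M"
    and x: "is_table x" "C *v x = t"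
    and path: "(marginal f x, v) \<in> (fiber_steps D N s)\<^sup>*"
  shows "\<exists>x'. (x, x') \<in> (fiber_steps C M t)\<^sup>* \<and> is_table x' \<and> C *v x' = t \<and>
    marginal f x' = v \<and> marginal f' x' = marginal f' x"
  using path
proof (induction rule: rtrancl_induct)
  case base
  then show ?case using x by blast
next
  case (step u v)
  then obtain x1 where x1: "(x, x1) \<in> (fiber_steps C M t)\<^sup>*" "is_table x1" "C *v x1 = t"
    "marginal f x1 = u" "marginal f' x1 = marginal f' x" by blast
  from step.hyps(2) obtain z where z: "z \<in> N" "v = u + z \<or> v = u - z"
    and fib: "is_table v" "D *v u = s" "D *v v = s"
    by (auto simp: fiber_steps_def fiber_def algebra_simps)
  have deg: "length (neg_cells z) = deg z"
    using length_neg_cells[OF hom moves[OF z(1)]] .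
  obtain ls x2 where x2: "length ls = deg z" "x2 = x1 + lift z ls \<or> x2 = x1 - lift z ls"
    "is_table x2" "marginal f x2 = v" "marginal f' x2 = marginal f' x1"
    using lift_step[OF deg x1(2) fib(1)] z(2) x1(4) by blast
  have "C *v x2 = t"
    using C[of x2 x1] x1(3,4) x2(4,5) fib(2,3) by simp
  moreover from this have "(x1, x2) \<in> fiber_steps C M t"
    using x1(2) x2(3) x1(3) M[OF z(1) x2(1)] x2(2) by (intro fiber_stepI)
  ultimately show ?case
    using x1 x2 by (metis rtrancl.rtrancl_into_rtrancl)
qed

end

interpretation rows: cell_coordinates fst snd Pair
  by standard auto

interpretation columns: cell_coordinates snd fst "\<lambda>k j. (j, k)"
  by standard auto

section \<open>Markov bases of Segre products\<close>

lemma finite_family_over_lists: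
  fixes F :: "'a \<Rightarrow> 'l::finite list \<Rightarrow> 'b"
  assumes "finite N"
  shows "finite {F z ls | z ls. z \<in> N \<and> length ls = n z}"
proof -
  have "{F z ls | z ls. z \<in> N \<and> length ls = n z} = (\<Union>z\<in>N. F z ` {ls. length ls = n z})"
    by auto
  moreover have "finite {ls :: 'l list. length ls = m}" for m
    using finite_lists_length_eq[of "UNIV :: 'l set" m] by simp
  ultimately show ?thesis using assms by simp
qed

theorem theorem2:
  fixes A :: "int ^ ('j::{finite,linorder}) ^ 'd"
    and B :: "int ^ ('k::{finite,linorder}) ^ 'e"
    and MA :: "(int ^ ('j::{finite,linorder})) set"
    and MB :: "(int ^ ('k::{finite,linorder})) set"
  assumes "homogeneous A" and "homogeneous B"
    and "markov_basis A MA" and "markov_basis B MB"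
  shows "markov_basis (segre_product A B)
    ({basic_move j1 j2 k1 k2 | j1 j2 k1 k2. True}
     \<union> {lift_left zA ks | zA ks. zA \<in> MA \<and> length ks = deg zA}
     \<union> {lift_right zB js | zB js. zB \<in> MB \<and> length js = deg zB})"
    (is "markov_basis ?C ?M")
proof -
  define M where "M = ?M"
  have finA: "finite MA" and movA: "\<And>z. z \<in> MA \<Longrightarrow> is_move A z"
    and conA: "\<And>s u v. u \<in> fiber A s \<Longrightarrow> v \<in> fiber A s \<Longrightarrow> (u, v) \<in> (fiber_steps A MA s)\<^sup>*"
    using assms(3) by (auto simp: markov_basis_def)
  have finB: "finite MB" and movB: "\<And>z. z \<in> MB \<Longrightarrow> is_move B z"
    and conB: "\<And>s u v. u \<in> fiber B s \<Longrightarrow> v \<in> fiber B s \<Longrightarrow> (u, v) \<in> (fiber_steps B MB s)\<^sup>*"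
    using assms(4) by (auto simp: markov_basis_def)
  have degA: "length (neg_cells z) = deg z" if "z \<in> MA" for z
    using length_neg_cells[OF assms(1) movA[OF that]] .
  have degB: "length (neg_cells z) = deg z" if "z \<in> MB" for z
    using length_neg_cells[OF assms(2) movB[OF that]] .
  have left: "lift_left z ks = rows.lift z ks" if "z \<in> MA" "length ks = deg z"
    for z and ks :: "'k list"
    using rows.lift_conv_sum[OF degA, of z ks] that by (simp add: lift_left_def)
  have right: "lift_right z js = columns.lift z js" if "z \<in> MB" "length js = deg z"
    for z and js :: "'j list"
    using columns.lift_conv_sum[OF degB, of z js] that by (simp add: lift_right_def)
  have basic_mem: "basic_move j1 j2 k1 k2 \<in> M" for j1 j2 k1 k2
    unfolding M_def by blast
  have left_mem: "rows.lift z ks \<in> M" if "z \<in> MA" "length ks = deg z" for z ks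
    unfolding M_def left[OF that, symmetric] using that by blast
  have right_mem: "columns.lift z js \<in> M" if "z \<in> MB" "length js = deg z" for z js
    unfolding M_def right[OF that, symmetric] using that by blast
  have fiberA: "?C *v x = ?C *v y"
    if "A *v marginal fst x = A *v marginal fst y" "marginal snd x = marginal snd y" for x y
    using that by (simp add: segre_product_mult_eq_iff)
  have fiberB: "?C *v x = ?C *v y"
    if "B *v marginal snd x = B *v marginal snd y" "marginal fst x = marginal fst y" for x y
    using that by (simp add: segre_product_mult_eq_iff)
  have "{basic_move j1 j2 k1 k2 | j1 j2 k1 k2. True}
      = range (\<lambda>(j1 :: 'j, j2, k1 :: 'k, k2). basic_move j1 j2 k1 k2)"
    by (auto simp: image_def)
  then have "finite {basic_move j1 j2 k1 k2 | (j1 :: 'j) j2 (k1 :: 'k) k2. True}"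
    by (metis finite finite_imageI)
  then have "finite M"
    unfolding M_def by (intro finite_UnI finite_family_over_lists finA finB)
  moreover have "is_move ?C z" if "z \<in> M" for z
    using that unfolding M_def
  proof (elim UnE CollectE exE conjE)
    fix j1 j2 k1 k2 assume "z = basic_move j1 j2 k1 k2"
    then show ?thesis
      by (simp add: is_move_segre_product marginal_basic_move) (simp add: is_move_def)
  next
    fix zA ks assume "z = lift_left zA ks" "zA \<in> MA" "length ks = deg zA"
    then show ?thesis
      using movA by (simp add: is_move_segre_product left degA rows.marginal_lift)
        (simp add: is_move_def)
  next
    fix zB js assume "z = lift_right zB js" "zB \<in> MB" "length js = deg zB"
    then show ?thesis
      using movB by (simp add: is_move_segre_product right degB columns.marginal_lift)
        (simp add: is_move_def)
  qed
  moreover have "(x, y) \<in> (fiber_steps ?C M t)\<^sup>*" if "x \<in> fiber ?C t" "y \<in> fiber ?C t" for x y t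
  proof -
    have x: "is_table x" "?C *v x = t" and y: "is_table y" "?C *v y = t"
      using that by (auto simp: fiber_def)
    then have eqA: "A *v marginal fst x = A *v marginal fst y"
      and eqB: "B *v marginal snd x = B *v marginal snd y"
      using segre_product_mult_eq_iff[of A B x y] by auto
    have "(marginal fst x, marginal fst y) \<in> (fiber_steps A MA (A *v marginal fst y))\<^sup>*"
      using x(1) y(1) eqA by (intro conA) (auto simp: fiber_def is_table_marginal)
    from rows.lift_path[OF assms(1) movA fiberA left_mem x this]
    obtain x1 where x1: "(x, x1) \<in> (fiber_steps ?C M t)\<^sup>*" "is_table x1" "?C *v x1 = t"
      "marginal fst x1 = marginal fst y" "marginal snd x1 = marginal snd x"
      by blast
    have "(marginal snd x1, marginal snd y) \<in> (fiber_steps B MB (B *v marginal snd y))\<^sup>*"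
      using x(1) x1(5) y(1) eqB by (intro conB) (auto simp: fiber_def is_table_marginal)
    from columns.lift_path[OF assms(2) movB fiberB right_mem x1(2,3) this]
    obtain x2 where x2: "(x1, x2) \<in> (fiber_steps ?C M t)\<^sup>*" "is_table x2" "?C *v x2 = t"
      "marginal snd x2 = marginal snd y" "marginal fst x2 = marginal fst x1"
      by blast
    have "(x2, y) \<in> (fiber_steps ?C M t)\<^sup>*"
      by (rule connected_by_basic_moves[OF basic_mem x2(2) y(1) x2(3)])
        (simp_all only: x1(4) x2(4,5))
    with x1(1) x2(1) show ?thesis by (meson rtrancl_trans)
  qed
  ultimately have "markov_basis ?C M"
    unfolding markov_basis_def by blast
  then show ?thesis by (simp only: M_def)
qed

end
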